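(* Let $a$ and $b$ be positive coprime integers. Then $$\sum_{i=1}^{\left\lfloor \frac{a}{2} \right\rfloor} \left\lfloor \frac{ib}{a} \right\rfloor + \sum_{i=1}^{\left\lfloor \frac{b}{2} \right\rfloor} \left\lfloor \frac{ia}{b} \right\rfloor = \left\lfloor \frac{a}{2} \right\rfloor \left\lfloor \frac{b}{2} \right\rfloor.$$
   Context: $\lfloor x \rfloor$ denotes the greatest integer less than or equal to $x$. Empty sums are equal to $0$. *)

theory Defs
  imports Complex_Main
begin

end

theory Submission
  imports Defs
begin

text \<open>
  The proof is the lattice-point count known from Eisenstein's proof of quadratic reciprocity.
  Consider the points \<open>(i, j)\<close> with \<open>1 \<le> i \<le> \<lfloor>a/2\<rfloor>\<close> and \<open>1 \<le> j \<le> \<lfloor>b/2\<rfloor>\<close>. The line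
  \<open>j * a = i * b\<close> through the origin and \<open>(a, b)\<close> contains none of them: since \<open>a\<close> and \<open>b\<close>
  are coprime, a point on it has \<open>a dvd i\<close>, which \<open>0 < i < a\<close> excludes. So each point lies
  strictly on one side. As \<open>i \<le> a/2\<close> gives \<open>i * b / a \<le> b/2\<close>, the whole column of positive
  lattice points over \<open>i\<close> under the line fits into the rectangle, and has \<open>\<lfloor>i * b / a\<rfloor>\<close> points
  (lemma \<open>floor_half_scaled_eq_count\<close>). The first sum therefore counts the points below the
  line, and by symmetry the second one counts those above it.
\<close>

text \<open>
  The bound on \<open>i\<close> ensures that cutting the count off at half of \<open>b\<close> loses nothing: every
  \<open>j\<close> with \<open>j * a \<le> i * b\<close> is at most \<open>b/2\<close>.
\<close>

lemma floor_half_scaled_eq_count: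
  fixes a b i :: int
  assumes "a > 0" "b > 0" "i \<ge> 0" "i \<le> \<lfloor>real_of_int a / 2\<rfloor>"
  shows "\<lfloor>real_of_int i * real_of_int b / real_of_int a\<rfloor>
       = (\<Sum>j = 1..\<lfloor>real_of_int b / 2\<rfloor>. of_bool (j * a \<le> i * b))"
proof -
  let ?k = "\<lfloor>real_of_int i * real_of_int b / real_of_int a\<rfloor>"
  have le_k: "j \<le> ?k \<longleftrightarrow> j * a \<le> i * b" for j
    using assms(1)
    by (simp add: le_floor_iff pos_le_divide_eq flip: of_int_mult)
  have "real_of_int i \<le> real_of_int a / 2"
    using assms(4) by (simp add: le_floor_iff)
  then have "real_of_int i * real_of_int b \<le> (real_of_int a / 2) * real_of_int b"
    using assms(2) by (intro mult_right_mono) auto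
  then have "real_of_int i * real_of_int b / real_of_int a \<le> real_of_int b / 2"
    using assms(1) by (simp add: pos_divide_le_eq mult.commute)
  then have k_le: "?k \<le> \<lfloor>real_of_int b / 2\<rfloor>"
    by (rule floor_mono)
  have "?k \<ge> 0"
    using assms by simp
  moreover have "{1..\<lfloor>real_of_int b / 2\<rfloor>} \<inter> {j. j * a \<le> i * b} = {1..?k}"
    using k_le by (auto simp flip: le_k)
  ultimately show ?thesis
    by (simp add: sum_of_bool_eq)
qed

theorem theorem6:
  fixes a b :: int
  assumes "a > 0" and "b > 0" and "coprime a b"
  shows "(\<Sum>i = 1..\<lfloor>real_of_int a / 2\<rfloor>. \<lfloor>real_of_int i * real_of_int b / real_of_int a\<rfloor>)
       + (\<Sum>i = 1..\<lfloor>real_of_int b / 2\<rfloor>. \<lfloor>real_of_int i * real_of_int a / real_of_int b\<rfloor>)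
       = \<lfloor>real_of_int a / 2\<rfloor> * \<lfloor>real_of_int b / 2\<rfloor>"
proof -
  define m n where "m = \<lfloor>real_of_int a / 2\<rfloor>" and "n = \<lfloor>real_of_int b / 2\<rfloor>"
  have nonneg: "m \<ge> 0" "n \<ge> 0"
    using assms by (simp_all add: m_def n_def)
  have "m < a"
    using assms(1) by (simp add: m_def floor_less_iff)
  have off_line: "j * a \<noteq> i * b" if "i \<in> {1..m}" for i j
  proof
    assume "j * a = i * b"
    then have "a dvd i * b"
      by (metis dvd_triv_right)
    then have "a dvd i"
      using assms(3) by (simp add: coprime_dvd_mult_left_iff)
    then show False
      using that \<open>m < a\<close> zdvd_imp_le[of a i] by auto
  qed
  have "(\<Sum>i = 1..m. \<lfloor>real_of_int i * real_of_int b / real_of_int a\<rfloor>)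
      = (\<Sum>i = 1..m. \<Sum>j = 1..n. of_bool (j * a \<le> i * b))"
    using assms(1,2) unfolding m_def n_def
    by (intro sum.cong refl floor_half_scaled_eq_count) auto
  moreover have "(\<Sum>j = 1..n. \<lfloor>real_of_int j * real_of_int a / real_of_int b\<rfloor>)
      = (\<Sum>j = 1..n. \<Sum>i = 1..m. of_bool (i * b \<le> j * a))"
    using assms(1,2) unfolding m_def n_def
    by (intro sum.cong refl floor_half_scaled_eq_count) auto
  moreover have "\<dots> = (\<Sum>i = 1..m. \<Sum>j = 1..n. of_bool (i * b \<le> j * a))"
    by (rule sum.swap)
  moreover have "(\<Sum>i = 1..m. \<Sum>j = 1..n. of_bool (j * a \<le> i * b))
        + (\<Sum>i = 1..m. \<Sum>j = 1..n. of_bool (i * b \<le> j * a))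
      = (\<Sum>i = 1..m. \<Sum>j = 1..n. 1 :: int)"
    unfolding sum.distrib[symmetric]
  proof (intro sum.cong refl)
    fix i j
    assume "i \<in> {1..m}"
    then show "of_bool (j * a \<le> i * b) + of_bool (i * b \<le> j * a) = (1 :: int)"
      using off_line[of i j] by (auto simp: of_bool_def)
  qed
  moreover have "(\<Sum>i = 1..m. \<Sum>j = 1..n. 1 :: int) = m * n"
    using nonneg by simp
  ultimately show ?thesis
    unfolding m_def n_def by linarith
qed

end
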